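(* For every positive integer $c$, $ms((2c,2c)) \leq 5\, m(c)^4$.
   Context: A graph-like scheduling problem on $n$ elements is a Boolean formula $\mathbf{S} = \bigwedge_{\alpha \in J} \mathbf{C}_\alpha$ ($J$ finite) where each clause is a disjunction $\mathbf{C} = \bigvee_{(i,j)\in I} (x_i \neq x_j)$ with $i,j \in [n]=\{1,\dots,n\}$ and $i \neq j$ for $(i,j)\in I$. Its size is $|\mathbf{S}| = |J|$. A solution is an assignment of a nonnegative integer to each $x_i$ making $\mathbf{S}$ true. $\mathbf{S}$ has property B if it has a solution in which each $x_i$, $i\in[n]$, is assigned $0$ or $1$. For a clause $\mathbf{C} = \bigvee_{(i,j)\in I} (x_i \neq x_j)$, $G_{\mathbf{C}}$ is the graph with vertex set $V_{\mathbf{C}} = \{i : (i,j)\in I \text{ or } (j,i)\in I \text{ for some } j\}$ and edge set $\{ij : (i,j)\in I\}$, and $\lambda(\mathbf{C})$ is the integer partition of $|V_{\mathbf{C}}|$ given by the sizes of the connected components of $G_{\mathbf{C}}$. Two clauses whose graphs have the same connected components (same vertex sets of components) are logically equivalent and are identified. Integer partitions are weakly decreasing finite sequences of positive integers. $\mathbf{S}$ is $\lambda$-uniform if $\lambda(\mathbf{C}_\alpha)=\lambda$ for every $\alpha\in J$. For a partition $\lambda$ with no part equal to $1$, $ms(\lambda)$ is the minimum possible size of a $\lambda$-uniform graph-like scheduling problem (on any number $n$ of elements) that does not have property B. A (finite) hypergraph $H=(V,E)$ consists of a finite vertex set $V$ and a set $E$ of subsets of $V$ (hyperedges); it is $c$-uniform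 if every hyperedge has size $c$. $H$ has property B if there is a map $\phi: V\to\{0,1\}$ such that no hyperedge $A$ is monochromatic (i.e. $|\phi(A)|>1$ for all $A\in E$). $m(c)$ is the minimum number of hyperedges in a $c$-uniform hypergraph that does not have property B. *)

theory Defs
  imports "HOL-Library.Multiset"
begin

text \<open>A clause, the disjunction of all \<open>x\<^sub>i \<noteq> x\<^sub>j\<close> with \<open>(i, j) \<in> I\<close>, is represented by its index set \<open>I\<close>.\<close>

type_synonym clause = "(nat \<times> nat) set"

definition is_clause :: "nat \<Rightarrow> clause \<Rightarrow> bool" where
  "is_clause n I \<longleftrightarrow> I \<subseteq> {1..n} \<times> {1..n} \<and> (\<forall>(i, j) \<in> I. i \<noteq> j)"

definition clause_true :: "(nat \<Rightarrow> nat) \<Rightarrow> clause \<Rightarrow> bool" where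
  "clause_true x I \<longleftrightarrow> (\<exists>(i, j) \<in> I. x i \<noteq> x j)"

definition clause_verts :: "clause \<Rightarrow> nat set" where
  "clause_verts I = {i. \<exists>j. (i, j) \<in> I \<or> (j, i) \<in> I}"

definition clause_edges :: "clause \<Rightarrow> nat set set" where
  "clause_edges I = {{i, j} | i j. (i, j) \<in> I}"

definition graph_components :: "'a set \<Rightarrow> 'a set set \<Rightarrow> 'a set set" where
  "graph_components V E = V // {(u, v). {u, v} \<in> E}\<^sup>*"

definition clause_components :: "clause \<Rightarrow> nat set set" where
  "clause_components I = graph_components (clause_verts I) (clause_edges I)"

text \<open>Integer partitions are weakly decreasing lists of positive integers.\<close>

definition clause_partition :: "clause \<Rightarrow> nat list" where
  "clause_partition I =
     rev (sorted_list_of_multiset (image_mset card (mset_set (clause_components I))))"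

text \<open>
  A problem on the elements \<open>1, \<dots>, n\<close> is the conjunction of the clauses \<open>C \<alpha>\<close> for \<open>\<alpha> \<in> J\<close>; its size
  is \<open>card J\<close>. Clauses are not literally identified when they have the same components: by
  \<open>clause_true_cong\<close> below, neither the truth of a clause nor its partition sees the difference.
  Hence merging such clauses in a problem keeps its solutions and can only lower its size, so that
  the minimum \<open>ms\<close> is the same with and without the identification.
\<close>

definition scheduling_problem :: "nat \<Rightarrow> 'j set \<Rightarrow> ('j \<Rightarrow> clause) \<Rightarrow> bool" where
  "scheduling_problem n J C \<longleftrightarrow> finite J \<and> (\<forall>\<alpha>\<in>J. is_clause n (C \<alpha>))"

definition is_solution :: "'j set \<Rightarrow> ('j \<Rightarrow> clause) \<Rightarrow> (nat \<Rightarrow> nat) \<Rightarrow> bool" where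
  "is_solution J C x \<longleftrightarrow> (\<forall>\<alpha>\<in>J. clause_true x (C \<alpha>))"

definition sched_property_B :: "nat \<Rightarrow> 'j set \<Rightarrow> ('j \<Rightarrow> clause) \<Rightarrow> bool" where
  "sched_property_B n J C \<longleftrightarrow> (\<exists>x. is_solution J C x \<and> (\<forall>i\<in>{1..n}. x i \<in> {0, 1}))"

definition sched_uniform :: "nat list \<Rightarrow> 'j set \<Rightarrow> ('j \<Rightarrow> clause) \<Rightarrow> bool" where
  "sched_uniform p J C \<longleftrightarrow> (\<forall>\<alpha>\<in>J. clause_partition (C \<alpha>) = p)"

text \<open>
  Since \<open>J\<close> is finite, it is no restriction to take it as a set of natural numbers. The value
  \<open>ms p\<close> is meaningful only for partitions \<open>p\<close> without parts equal to 1.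
\<close>

definition ms :: "nat list \<Rightarrow> nat" where
  "ms p = (LEAST k. \<exists>n (J :: nat set) C. scheduling_problem n J C \<and> sched_uniform p J C \<and>
     \<not> sched_property_B n J C \<and> card J = k)"

definition hypergraph :: "'a set \<Rightarrow> 'a set set \<Rightarrow> bool" where
  "hypergraph V E \<longleftrightarrow> finite V \<and> E \<subseteq> Pow V"

definition hyper_uniform :: "nat \<Rightarrow> 'a set set \<Rightarrow> bool" where
  "hyper_uniform c E \<longleftrightarrow> (\<forall>A\<in>E. card A = c)"

definition hyper_property_B :: "'a set \<Rightarrow> 'a set set \<Rightarrow> bool" where
  "hyper_property_B V E \<longleftrightarrow> (\<exists>\<phi> :: 'a \<Rightarrow> nat. \<phi> ` V \<subseteq> {0, 1} \<and> (\<forall>A\<in>E. card (\<phi> ` A) > 1))"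

text \<open>Since \<open>V\<close> is finite, it is no restriction to take the vertices to be natural numbers.\<close>

definition m_hyper :: "nat \<Rightarrow> nat" where
  "m_hyper c = (LEAST k. \<exists>(V :: nat set) E. hypergraph V E \<and> hyper_uniform c E \<and>
     \<not> hyper_property_B V E \<and> card E = k)"

lemma clause_true_iff_component:
  "clause_true x I \<longleftrightarrow> (\<exists>K \<in> clause_components I. \<exists>i\<in>K. \<exists>j\<in>K. x i \<noteq> x j)"
proof
  define R where "R = {(u, v). {u, v} \<in> clause_edges I}"
  have R: "(u, v) \<in> R \<longleftrightarrow> (u, v) \<in> I \<or> (v, u) \<in> I" for u v
    unfolding R_def clause_edges_def by (auto simp: doubleton_eq_iff)
  have comps: "clause_components I = clause_verts I // R\<^sup>*"
    by (simp add: clause_components_def graph_components_def R_def)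
  { assume "clause_true x I"
    then obtain i j where ij: "(i, j) \<in> I" "x i \<noteq> x j"
      by (auto simp: clause_true_def)
    have "R\<^sup>* `` {i} \<in> clause_components I"
      using ij by (auto simp: comps clause_verts_def intro: quotientI)
    moreover have "i \<in> R\<^sup>* `` {i}" "j \<in> R\<^sup>* `` {i}"
      using ij R by auto
    ultimately show "\<exists>K \<in> clause_components I. \<exists>i\<in>K. \<exists>j\<in>K. x i \<noteq> x j"
      using ij by blast }
  { assume "\<exists>K \<in> clause_components I. \<exists>i\<in>K. \<exists>j\<in>K. x i \<noteq> x j"
    then obtain a i j where aij: "(a, i) \<in> R\<^sup>*" "(a, j) \<in> R\<^sup>*" "x i \<noteq> x j"
      by (auto simp: comps elim!: quotientE)
    show "clause_true x I"
    proof (rule ccontr)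
      assume "\<not> clause_true x I"
      then have eq: "x u = x v" if "(u, v) \<in> R" for u v
        using that R by (fastforce simp: clause_true_def)
      have "x u = x v" if "(u, v) \<in> R\<^sup>*" for u v
        using that by (induction rule: rtrancl_induct) (auto dest: eq)
      then show False
        using aij by metis
    qed }
qed

lemma clause_true_cong:
  assumes "clause_components I = clause_components I'"
  shows "clause_true x I = clause_true x I'" "clause_partition I = clause_partition I'"
  using assms by (simp_all add: clause_true_iff_component clause_partition_def)

text \<open>The minimum in \<open>m_hyper\<close> is over a nonempty set, so it is attained.\<close>

lemma ex_not_hyper_property_B:
  assumes "c > 0"
  shows "\<exists>(V :: nat set) E. hypergraph V E \<and> hyper_uniform c E \<and> \<not> hyper_property_B V E"
proof (intro exI conjI)
  let ?V = "{..<2 * c - 1}" and ?E = "{A. A \<subseteq> {..<2 * c - 1} \<and> card A = c}"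
  show "hypergraph ?V ?E" "hyper_uniform c ?E"
    by (auto simp: hypergraph_def hyper_uniform_def)
  show "\<not> hyper_property_B ?V ?E"
  proof
    assume "hyper_property_B ?V ?E"
    then obtain f :: "nat \<Rightarrow> nat" where f: "f ` ?V \<subseteq> {0, 1}" "\<forall>A\<in>?E. card (f ` A) > 1"
      unfolding hyper_property_B_def by (elim exE conjE)
    define P where "P v = {i \<in> ?V. f i = v}" for v
    have "?V = P 0 \<union> P 1"
      using f(1) by (auto simp: P_def image_subset_iff)
    then have "card ?V \<le> card (P 0) + card (P 1)"
      using card_Un_le[of "P 0" "P 1"] by simp
    then have "c \<le> card (P 0) \<or> c \<le> card (P 1)"
      using assms by auto
    then obtain v where "c \<le> card (P v)" by blast
    then obtain A where A: "A \<subseteq> P v" "card A = c"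
      by (meson obtain_subset_with_card_n)
    then have "card (f ` A) > 1"
      using f(2) by (auto simp: P_def)
    moreover have "f ` A \<subseteq> {v}"
      using A by (auto simp: P_def)
    then have "card (f ` A) \<le> 1"
      using card_mono[of "{v}" "f ` A"] by simp
    ultimately show False by simp
  qed
qed

end

theory Submission
  imports Defs
begin

text \<open>
  Take a \<open>c\<close>-uniform hypergraph without property B that has \<open>m = m(c)\<close> hyperedges, and put five
  disjoint copies of it, numbered modulo 5, on the elements of a scheduling problem. Under an
  assignment of 0 and 1, every copy contains a monochromatic hyperedge. If two copies have
  monochromatic hyperedges of the same colour, their union is a monochromatic set of size \<open>2c\<close>;
  a clause with two components of size \<open>2c\<close> is falsified once both components arise in this way.
  So it suffices to provide the clauses for enough ways to choose two disjoint pairs of copies.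

  Five of the fifteen ways are enough: place the copies on a pentagon and, for each corner \<open>k\<close>, take
  the two pairs \<open>{k + 1, k - 1}\<close> and \<open>{k + 2, k - 2}\<close> of corners that the reflection fixing \<open>k\<close>
  swaps. They meet every 2-colouring of the corners (lemma \<open>pentagon_monochromatic_pairs\<close>). With
  \<open>m\<^sup>4\<close> choices of the four hyperedges for each corner, this makes at most \<open>5 m\<^sup>4\<close> clauses.
\<close>

section \<open>Reaching the two minima\<close>

lemma ms_le_card:
  assumes fin: "finite F" and clauses: "\<And>I. I \<in> F \<Longrightarrow> is_clause n I"
    and parts: "\<And>I. I \<in> F \<Longrightarrow> clause_partition I = p"
    and false_clause: "\<And>x. (\<forall>i\<in>{1..n}. x i \<in> {0, 1}) \<Longrightarrow> \<exists>I\<in>F. \<not> clause_true x I"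
  shows "ms p \<le> card F"
proof -
  obtain C where C: "bij_betw C {..<card F} F"
    using ex_bij_betw_nat_finite[OF fin] by (auto simp: atLeast0LessThan)
  then have im: "C ` {..<card F} = F"
    by (simp add: bij_betw_def)
  have "scheduling_problem n {..<card F} C"
    using im clauses by (auto simp: scheduling_problem_def)
  moreover have "sched_uniform p {..<card F} C"
    using im parts by (auto simp: sched_uniform_def)
  moreover have "\<not> sched_property_B n {..<card F} C"
  proof
    assume "sched_property_B n {..<card F} C"
    then obtain x where x: "\<forall>\<alpha>\<in>{..<card F}. clause_true x (C \<alpha>)"
      and "\<forall>i\<in>{1..n}. x i \<in> {0, 1}"
      unfolding sched_property_B_def is_solution_def by (elim exE conjE)
    then obtain I where "I \<in> F" "\<not> clause_true x I"
      using false_clause by metis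
    with x im show False by (metis imageE)
  qed
  ultimately show ?thesis
    unfolding ms_def by (intro Least_le exI[of _ n] exI[of _ "{..<card F}"] exI[of _ C]) simp
qed

lemma m_hyper_attained:
  assumes "c > 0"
  obtains V :: "nat set" and E where "hypergraph V E" "hyper_uniform c E"
    "\<not> hyper_property_B V E" "card E = m_hyper c"
proof -
  have "\<exists>k (V :: nat set) E. hypergraph V E \<and> hyper_uniform c E \<and>
      \<not> hyper_property_B V E \<and> card E = k"
    using ex_not_hyper_property_B[OF assms] by blast
  from LeastI_ex[OF this] show ?thesis
    using that unfolding m_hyper_def by blast
qed

section \<open>Clauses with two components\<close>

text \<open>The clause whose graph is the disjoint union of the complete graphs on \<open>K\<close> and \<open>L\<close>.\<close>

definition two_block_clause :: "nat set \<Rightarrow> nat set \<Rightarrow> clause" where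
  "two_block_clause K L = {(i, j). i \<noteq> j \<and> (i \<in> K \<and> j \<in> K \<or> i \<in> L \<and> j \<in> L)}"

lemma is_clause_two_block_clause:
  assumes "K \<subseteq> {1..n}" "L \<subseteq> {1..n}"
  shows "is_clause n (two_block_clause K L)"
  using assms by (auto simp: is_clause_def two_block_clause_def)

lemma two_block_clause_false:
  assumes "\<And>i. i \<in> K \<Longrightarrow> x i = a" "\<And>i. i \<in> L \<Longrightarrow> x i = b"
  shows "\<not> clause_true x (two_block_clause K L)"
  using assms by (auto simp: clause_true_def two_block_clause_def)

lemma exists_other_element:
  assumes "card K \<ge> 2"
  shows "\<exists>j\<in>K. j \<noteq> i"
proof (rule ccontr)
  assume "\<not> (\<exists>j\<in>K. j \<noteq> i)"
  then have "K \<subseteq> {i}" by blast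
  then have "card K \<le> 1" using card_mono[of "{i}" K] by simp
  with assms show False by simp
qed

text \<open>
  A block with only one element would contribute no vertex to the graph, since its only pair
  \<open>(i, i)\<close> is not an edge; hence the bound on the cardinalities.
\<close>

lemma components_two_block_clause:
  assumes disj: "K \<inter> L = {}" and K: "card K \<ge> 2" and L: "card L \<ge> 2"
  shows "clause_components (two_block_clause K L) = {K, L}"
proof -
  let ?I = "two_block_clause K L"
  define R where "R = {(u, v). {u, v} \<in> clause_edges ?I}"
  have R: "(u, v) \<in> R \<longleftrightarrow> u \<noteq> v \<and> (u \<in> K \<and> v \<in> K \<or> u \<in> L \<and> v \<in> L)" for u v
    unfolding R_def clause_edges_def two_block_clause_def by (auto simp: doubleton_eq_iff)
  have verts: "clause_verts ?I = K \<union> L"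
    using exists_other_element[OF K] exists_other_element[OF L]
    unfolding clause_verts_def two_block_clause_def by (auto; metis)
  have inv: "(v \<in> K \<longleftrightarrow> u \<in> K) \<and> (v \<in> L \<longleftrightarrow> u \<in> L)" if "(u, v) \<in> R\<^sup>*" for u v
    using that by (induction rule: rtrancl_induct) (use disj R in blast)+
  have reach: "(u, v) \<in> R\<^sup>*" if "u \<in> K \<and> v \<in> K \<or> u \<in> L \<and> v \<in> L" for u v
    using that R[of u v] by (cases "u = v") auto
  have clsK: "R\<^sup>* `` {u} = K" if "u \<in> K" for u
    using that inv reach by blast
  have clsL: "R\<^sup>* `` {u} = L" if "u \<in> L" for u
    using that inv reach by blast
  have "K \<noteq> {}" "L \<noteq> {}" using K L by auto
  then have "(K \<union> L) // R\<^sup>* = {K, L}"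
    using clsK clsL by (auto simp: quotient_def)
  then show ?thesis
    by (simp add: clause_components_def graph_components_def verts flip: R_def)
qed

lemma partition_two_block_clause:
  assumes "K \<inter> L = {}" "card K = d" "card L = d" "d \<ge> 2"
  shows "clause_partition (two_block_clause K L) = [d, d]"
proof -
  have "K \<noteq> L" using assms by auto
  then show ?thesis
    using assms by (simp add: clause_partition_def components_two_block_clause)
qed

section \<open>Monochromatic pairs in the pentagon\<close>

text \<open>
  At least three corners have the same colour. If exactly four have it, let \<open>k\<close> be the exceptional
  corner; if all five have it, any \<open>k\<close> will do. Otherwise two corners have the other colour, and every pair of corners, be it
  a side or a diagonal of the pentagon, is swapped by the reflection fixing some \<open>k\<close>; the second
  pair swapped by it then lies among the three corners of the majority colour.
\<close>

lemma pentagon_monochromatic_pairs: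
  fixes t :: "nat \<Rightarrow> nat"
  assumes "\<And>k. k < 5 \<Longrightarrow> t k \<in> {0, 1}"
  shows "\<exists>k<5. t ((k + 1) mod 5) = t ((k + 4) mod 5) \<and> t ((k + 2) mod 5) = t ((k + 3) mod 5)"
proof -
  have "t 0 \<in> {0, 1}" "t 1 \<in> {0, 1}" "t 2 \<in> {0, 1}" "t 3 \<in> {0, 1}" "t 4 \<in> {0, 1}"
    using assms by simp_all
  then have "t 1 = t 4 \<and> t 2 = t 3 \<or> t 2 = t 0 \<and> t 3 = t 4 \<or> t 3 = t 1 \<and> t 4 = t 0 \<or>
      t 4 = t 2 \<and> t 0 = t 1 \<or> t 0 = t 3 \<and> t 1 = t 2"
    by (elim insertE emptyE) simp_all
  then have "\<exists>k\<in>{0, 1, 2, 3, 4 :: nat}.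
      t ((k + 1) mod 5) = t ((k + 4) mod 5) \<and> t ((k + 2) mod 5) = t ((k + 3) mod 5)"
    by (simp add: numeral_2_eq_2)
  moreover have "k < 5" if "k \<in> {0, 1, 2, 3, 4}" for k :: nat
    using that by auto
  ultimately show ?thesis by blast
qed

section \<open>Five copies of a hypergraph\<close>

lemma monochromatic_edge:
  assumes H: "hypergraph V E" "\<not> hyper_property_B V E" and nonempty: "{} \<notin> E"
    and f: "\<And>v. v \<in> V \<Longrightarrow> f v \<in> {0, 1 :: nat}"
  shows "\<exists>A\<in>E. \<exists>t\<in>{0, 1}. \<forall>v\<in>A. f v = t"
proof -
  have "f ` V \<subseteq> {0, 1}" using f by (rule image_subsetI)
  then obtain A where A: "A \<in> E" "\<not> card (f ` A) > 1"
    using H(2) unfolding hyper_property_B_def by blast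
  have sub: "A \<subseteq> V" and "finite V" using A H(1) by (auto simp: hypergraph_def)
  then have fin: "finite (f ` A)" using finite_subset by blast
  obtain a where a: "a \<in> A" using A(1) nonempty by (metis all_not_in_conv)
  have "f v = f a" if "v \<in> A" for v
    using A(2) fin a that by (metis card_le_Suc0_iff_eq One_nat_def imageI not_le)
  moreover have "f a \<in> {0, 1}" using f sub a by blast
  ultimately show ?thesis using A(1) by blast
qed

text \<open>
  The copies of the vertices \<open>0, \<dots>, N - 1\<close> for \<open>k = 0, \<dots>, 4\<close> partition the elements
  \<open>1, \<dots>, 5 N\<close>.
\<close>

definition vertex_copy :: "nat \<Rightarrow> nat \<Rightarrow> nat" where
  "vertex_copy k v = 5 * v + k + 1"

lemma vertex_copy_eq_iff:
  assumes "k < 5" "l < 5"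
  shows "vertex_copy k v = vertex_copy l w \<longleftrightarrow> k = l \<and> v = w"
proof
  assume "vertex_copy k v = vertex_copy l w"
  then have eq: "5 * v + k = 5 * w + l" by (simp add: vertex_copy_def)
  have "k = (5 * v + k) mod 5" using assms(1) by simp
  also have "\<dots> = l" using assms(2) by (simp add: eq)
  finally show "k = l \<and> v = w" using eq by simp
qed simp

definition edge_pair :: "nat \<Rightarrow> nat set \<Rightarrow> nat \<Rightarrow> nat set \<Rightarrow> nat set" where
  "edge_pair k A l B = vertex_copy k ` A \<union> vertex_copy l ` B"

lemma card_edge_pair:
  assumes "k < 5" "l < 5" "k \<noteq> l" "finite A" "finite B"
  shows "card (edge_pair k A l B) = card A + card B"
proof -
  have "inj (vertex_copy k)" "inj (vertex_copy l)"
    by (auto simp: inj_def vertex_copy_def)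
  then have "card (vertex_copy k ` A) = card A" "card (vertex_copy l ` B) = card B"
    by (meson card_image inj_on_subset subset_UNIV)+
  moreover have "vertex_copy k ` A \<inter> vertex_copy l ` B = {}"
    using assms by (auto simp: vertex_copy_eq_iff)
  ultimately show ?thesis
    using assms by (simp add: edge_pair_def card_Un_disjoint)
qed

lemma disjoint_edge_pairs:
  assumes "k < 5" "l < 5" "k' < 5" "l' < 5" and "k \<noteq> k'" "k \<noteq> l'" "l \<noteq> k'" "l \<noteq> l'"
  shows "edge_pair k A l B \<inter> edge_pair k' C l' D = {}"
  using assms by (auto simp: edge_pair_def vertex_copy_eq_iff)

text \<open>Modulo 5, the corners \<open>k + 4\<close> and \<open>k + 3\<close> are \<open>k - 1\<close> and \<open>k - 2\<close>.\<close>

definition pentagon_clause :: "nat \<Rightarrow> nat set \<Rightarrow> nat set \<Rightarrow> nat set \<Rightarrow> nat set \<Rightarrow> clause" where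
  "pentagon_clause k A B C D = two_block_clause
     (edge_pair ((k + 1) mod 5) A ((k + 4) mod 5) B)
     (edge_pair ((k + 2) mod 5) C ((k + 3) mod 5) D)"

lemma partition_pentagon_clause:
  assumes "k < 5" "c > 0" and card: "card A = c" "card B = c" "card C = c" "card D = c"
  shows "clause_partition (pentagon_clause k A B C D) = [2 * c, 2 * c]"
proof -
  have fin: "finite A" "finite B" "finite C" "finite D"
    using assms by (auto intro: card_ge_0_finite)
  have less: "j mod 5 < 5" for j :: nat by simp
  have "k \<in> {0, 1, 2, 3, 4}" using \<open>k < 5\<close> by auto
  then have corners: "(k + 1) mod 5 \<noteq> (k + 4) mod 5" "(k + 2) mod 5 \<noteq> (k + 3) mod 5"
    "(k + 1) mod 5 \<noteq> (k + 2) mod 5" "(k + 1) mod 5 \<noteq> (k + 3) mod 5"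
    "(k + 4) mod 5 \<noteq> (k + 2) mod 5" "(k + 4) mod 5 \<noteq> (k + 3) mod 5"
    by (elim insertE emptyE; simp)+
  show ?thesis
    unfolding pentagon_clause_def
  proof (rule partition_two_block_clause)
    show "edge_pair ((k + 1) mod 5) A ((k + 4) mod 5) B \<inter>
        edge_pair ((k + 2) mod 5) C ((k + 3) mod 5) D = {}"
      by (rule disjoint_edge_pairs[OF less less less less corners(3-6)])
    show "card (edge_pair ((k + 1) mod 5) A ((k + 4) mod 5) B) = 2 * c"
      unfolding card_edge_pair[OF less less corners(1) fin(1,2)] card by simp
    show "card (edge_pair ((k + 2) mod 5) C ((k + 3) mod 5) D) = 2 * c"
      unfolding card_edge_pair[OF less less corners(2) fin(3,4)] card by simp
    show "2 * c \<ge> 2"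
      using \<open>c > 0\<close> by simp
  qed
qed

text \<open>
  Here \<open>A l\<close> is a hyperedge whose copy number \<open>l\<close> is monochromatic of colour \<open>t l\<close>. The two blocks
  of the clause need not have the same colour as each other.
\<close>

lemma pentagon_clause_false:
  assumes mono: "\<And>l v. l < 5 \<Longrightarrow> v \<in> A l \<Longrightarrow> x (vertex_copy l v) = t l"
    and t: "t ((k + 1) mod 5) = t ((k + 4) mod 5)" "t ((k + 2) mod 5) = t ((k + 3) mod 5)"
  shows "\<not> clause_true x (pentagon_clause k (A ((k + 1) mod 5)) (A ((k + 4) mod 5))
    (A ((k + 2) mod 5)) (A ((k + 3) mod 5)))"
proof -
  have pair: "x i = t l" if "i \<in> edge_pair l (A l) l' (A l')" "t l = t l'" "l < 5" "l' < 5" for i l l'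
    using that mono by (auto simp: edge_pair_def)
  have less: "j mod 5 < 5" for j :: nat by simp
  show ?thesis
    unfolding pentagon_clause_def
    by (rule two_block_clause_false) (erule pair[OF _ t(1) less less], erule pair[OF _ t(2) less less])
qed

lemma is_clause_pentagon_clause:
  assumes "A \<subseteq> {..<N}" "B \<subseteq> {..<N}" "C \<subseteq> {..<N}" "D \<subseteq> {..<N}"
  shows "is_clause (5 * N) (pentagon_clause k A B C D)"
proof -
  have "vertex_copy (l mod 5) ` X \<subseteq> {1..5 * N}" if "X \<subseteq> {..<N}" for l X
  proof -
    have "vertex_copy (l mod 5) v \<in> {1..5 * N}" if "v < N" for v
    proof -
      have "l mod 5 < 5" by simp
      then show ?thesis using that unfolding vertex_copy_def atLeastAtMost_iff by linarith
    qed
    then show ?thesis using that by blast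
  qed
  then show ?thesis
    unfolding pentagon_clause_def edge_pair_def using assms
    by (intro is_clause_two_block_clause Un_least)
qed

section \<open>The bound\<close>

theorem theorem2p12:
  fixes c :: nat
  assumes "c > 0"
  shows "ms [2 * c, 2 * c] \<le> 5 * m_hyper c ^ 4"
proof -
  obtain V :: "nat set" and E where H: "hypergraph V E" "hyper_uniform c E"
    "\<not> hyper_property_B V E" "card E = m_hyper c"
    using m_hyper_attained[OF assms] .
  have "finite V" and EV: "\<And>A. A \<in> E \<Longrightarrow> A \<subseteq> V"
    using H(1) by (auto simp: hypergraph_def)
  then have "finite E"
    using H(1) by (auto simp: hypergraph_def intro: finite_subset)
  have cardE: "\<And>A. A \<in> E \<Longrightarrow> card A = c"
    using H(2) by (auto simp: hyper_uniform_def)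
  then have "{} \<notin> E" using assms by fastforce
  obtain N where N: "V \<subseteq> {..<N}"
    using \<open>finite V\<close> unfolding finite_nat_set_iff_bounded by blast
  \<comment> \<open>A corner of the pentagon and one hyperedge for each of the four other copies.\<close>
  define P where "P = {..<5::nat} \<times> E \<times> E \<times> E \<times> E"
  define F where "F = (\<lambda>(k, A, B, C, D). pentagon_clause k A B C D) ` P"
  have "ms [2 * c, 2 * c] \<le> card F"
  proof (rule ms_le_card[where n = "5 * N"])
    show "finite F" using \<open>finite E\<close> by (simp add: F_def P_def)
  next
    fix I assume "I \<in> F"
    then obtain k A B C D where I: "I = pentagon_clause k A B C D" and "k < 5"
      and E: "A \<in> E" "B \<in> E" "C \<in> E" "D \<in> E"
      by (auto simp: F_def P_def)
    show "is_clause (5 * N) I"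
      unfolding I using E EV N by (intro is_clause_pentagon_clause) blast+
    show "clause_partition I = [2 * c, 2 * c]"
      unfolding I using assms \<open>k < 5\<close> E cardE by (intro partition_pentagon_clause)
  next
    fix x :: "nat \<Rightarrow> nat" assume x: "\<forall>i\<in>{1..5 * N}. x i \<in> {0, 1}"
    have "\<exists>A t. A \<in> E \<and> t \<in> {0, 1} \<and> (\<forall>v\<in>A. x (vertex_copy k v) = t)" if "k < 5" for k
    proof -
      have "x (vertex_copy k v) \<in> {0, 1}" if "v \<in> V" for v
      proof -
        have "v < N" using N that by blast
        then have "vertex_copy k v \<in> {1..5 * N}"
          using \<open>k < 5\<close> by (simp add: vertex_copy_def)
        then show ?thesis using x by blast
      qed
      then show ?thesis
        using monochromatic_edge[OF H(1,3) \<open>{} \<notin> E\<close>, of "\<lambda>v. x (vertex_copy k v)"] by blast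
    qed
    then obtain A t where A: "\<And>k. k < 5 \<Longrightarrow> A k \<in> E" and t: "\<And>k. k < 5 \<Longrightarrow> t k \<in> {0, 1}"
      and At: "\<And>k v. k < 5 \<Longrightarrow> v \<in> A k \<Longrightarrow> x (vertex_copy k v) = t k"
      by metis
    obtain k where k: "k < 5" "t ((k + 1) mod 5) = t ((k + 4) mod 5)"
      "t ((k + 2) mod 5) = t ((k + 3) mod 5)"
      using pentagon_monochromatic_pairs[of t, OF t] by blast
    let ?I = "pentagon_clause k (A ((k + 1) mod 5)) (A ((k + 4) mod 5))
      (A ((k + 2) mod 5)) (A ((k + 3) mod 5))"
    have "?I \<in> F"
      unfolding F_def P_def
      by (rule image_eqI[of _ _ "(k, A ((k + 1) mod 5), A ((k + 4) mod 5),
        A ((k + 2) mod 5), A ((k + 3) mod 5))"]) (simp_all add: k(1) A)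
    moreover have "\<not> clause_true x ?I"
      by (rule pentagon_clause_false[OF At k(2,3)])
    ultimately show "\<exists>I\<in>F. \<not> clause_true x I" by blast
  qed
  also have "card F \<le> card P"
    unfolding F_def by (rule card_image_le) (simp add: P_def \<open>finite E\<close>)
  also have "card P = 5 * m_hyper c ^ 4"
    by (simp add: P_def card_cartesian_product H(4) power4_eq_xxxx)
  finally show ?thesis .
qed

end
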